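(* Let $\mathcal{A}=\{A_\sigma\}_{\sigma\in\Sigma}$ be a finite family of real $n\times n$ matrices indexed by $\Sigma=\{1,\dots,m\}$, let $\mathcal{W}=\{1,\dots,p\}$, let $(i,\sigma)\mapsto i\cdot\sigma$ be a map from $\mathcal{W}\times\Sigma$ to $\mathcal{W}$, and let $T$ be the associated tropical Kraus map. If the set of $np\times np$ matrices $\{E_{ij}\otimes A_\sigma : i,j\in\mathcal{W},\ \sigma\in\Sigma,\ i\cdot\sigma=j\}$ is irreducible, then $T$ has a positive definite eigenvector, i.e. there exist $\lambda\in\mathbb{R}$ and $X=(X_1,\dots,X_p)$ with every $X_j$ positive definite such that $\lambda X_j\in T_j(X)$ for all $j\in\mathcal{W}$.
   Context: $\mathcal{S}_n$ is the space of real symmetric $n\times n$ matrices with the Löwner order ($P\preceq Q$ iff $Q-P$ is positive semidefinite), and $\mathcal{S}_n^+$ is the set of positive semidefinite matrices. For a finite set $\mathcal{Q}\subset\mathcal{S}_n$, $\bigvee\mathcal{Q}$ denotes the set of all minimal upper bounds of $\mathcal{Q}$, i.e. of all $S\in\mathcal{S}_n$ with $S\succeq Q$ for all $Q\in\mathcal{Q}$ and such that any $Y\in\mathcal{S}_n$ with $Y\succeq Q$ for all $Q\in\mathcal{Q}$ and $Y\preceq S$ equals $S$. The tropical Kraus map $T$ sends $X=(X_1,\dots,X_p)\in(\mathcal{S}_n^+)^p$ to the tuple of sets $(T_j(X))_{j\in\mathcal{W}}$, where $$T_j(X)=\bigvee\{A_\sigma^\top X_iA_\sigma : (i,\sigma)\in\mathcal{W}\times\Sigma,\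 i\cdot\sigma=j\}.$$ $E_{ij}$ is the $p\times p$ matrix with $1$ in entry $(i,j)$ and $0$ elsewhere, and $\otimes$ is the Kronecker product. A set of real square matrices of size $N$ is irreducible if no subspace of $\mathbb{R}^N$ other than $\{0\}$ and $\mathbb{R}^N$ is invariant under every matrix of the set. *)

theory Defs
  imports "HOL-Analysis.Analysis"
begin

definition sym_mat :: "real^'n^'n \<Rightarrow> bool" where
  "sym_mat P \<longleftrightarrow> transpose P = P"

definition pos_semidef :: "real^'n^'n \<Rightarrow> bool" where
  "pos_semidef P \<longleftrightarrow> sym_mat P \<and> (\<forall>x. 0 \<le> x \<bullet> (P *v x))"

definition pos_def :: "real^'n^'n \<Rightarrow> bool" where
  "pos_def P \<longleftrightarrow> sym_mat P \<and> (\<forall>x. x \<noteq> 0 \<longrightarrow> 0 < x \<bullet> (P *v x))"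

definition loewner_le :: "real^'n^'n \<Rightarrow> real^'n^'n \<Rightarrow> bool"  (infix \<open>\<preceq>\<^sub>L\<close> 50) where
  "P \<preceq>\<^sub>L Q \<longleftrightarrow> pos_semidef (Q - P)"

text \<open>
  The order \<open>\<preceq>\<^sub>L\<close> only constrains the difference of its arguments, so membership of the
  upper bounds in the space of symmetric matrices is required explicitly.
\<close>

definition sym_upper_bounds :: "(real^'n^'n) set \<Rightarrow> (real^'n^'n) set" where
  "sym_upper_bounds \<Q> = {S. sym_mat S \<and> (\<forall>Q\<in>\<Q>. Q \<preceq>\<^sub>L S)}"

definition minimal_upper_bounds :: "(real^'n^'n) set \<Rightarrow> (real^'n^'n) set" where
  "minimal_upper_bounds \<Q> =
     {S \<in> sym_upper_bounds \<Q>. \<forall>Y \<in> sym_upper_bounds \<Q>. Y \<preceq>\<^sub>L S \<longrightarrow> Y = S}"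

text \<open>
  The state set and the alphabet are the finite types \<open>'w\<close> and \<open>'s\<close>, \<open>act i \<sigma>\<close> is the state
  \<open>i \<cdot> \<sigma>\<close>, and \<open>tropical_kraus A act X j\<close> is the \<open>j\<close>-th component of the image of \<open>X\<close>. The map is
  meant to be applied to tuples of positive semidefinite matrices only.
\<close>

definition tropical_kraus ::
  "('s::finite \<Rightarrow> real^'n^'n) \<Rightarrow> ('w::finite \<Rightarrow> 's \<Rightarrow> 'w) \<Rightarrow> ('w \<Rightarrow> real^'n^'n) \<Rightarrow> 'w \<Rightarrow> (real^'n^'n) set"
  where
  "tropical_kraus A act X j =
     minimal_upper_bounds {transpose (A \<sigma>) ** X i ** A \<sigma> | i \<sigma>. act i \<sigma> = j}"

definition matrix_unit :: "'w \<Rightarrow> 'w \<Rightarrow> real^'w^'w" where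
  "matrix_unit i j = (\<chi> k l. if k = i \<and> l = j then 1 else 0)"

text \<open>Rows and columns of a Kronecker product are indexed by pairs (block index, inner index).\<close>

definition kronecker :: "real^'b^'a \<Rightarrow> real^'d^'c \<Rightarrow> real^('b \<times> 'd)^('a \<times> 'c)" (infixl \<open>\<otimes>\<^sub>K\<close> 70) where
  "B \<otimes>\<^sub>K C = (\<chi> r c. B $ fst r $ fst c * C $ snd r $ snd c)"

definition irreducible_mats :: "(real^'k^'k) set \<Rightarrow> bool" where
  "irreducible_mats M \<longleftrightarrow>
     (\<forall>V. subspace V \<and> (\<forall>B\<in>M. \<forall>v\<in>V. B *v v \<in> V) \<longrightarrow> V = {0} \<or> V = UNIV)"

end

theory Submission
  imports Defs
begin

text \<open>
  Every family of positive semidefinite matrices has a distinguished minimal upper bound: the one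
  of least Frobenius norm. The upper bounds form a nonempty closed convex set, so it exists and is
  unique, and it is minimal because the Frobenius norm is strictly increasing on positive
  semidefinite matrices (\<open>loewner_le_norm_le_imp_eq\<close>); this in turn rests on the fact that the
  cone of positive semidefinite matrices has nonnegative inner products
  (\<open>pos_semidef_inner_nonneg\<close>). The bound varies continuously with the family, also where the
  matrices are singular (\<open>continuous_on_least_norm_ub\<close>). Choosing it in every component thus
  turns the set-valued map \<open>T\<close> into a continuous single-valued map \<open>F\<close> with
  \<open>F X $ j \<in> T\<^sub>j X\<close>.

  The tuples of positive semidefinite matrices with total trace one form a compact convex set. If
  \<open>F\<close> vanishes at one of them, that tuple is an eigenvector for the eigenvalue \<open>0\<close>. Otherwise \<open>F\<close>
  divided by its trace maps the set continuously into itself, and a fixed point given by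
  Brouwer's theorem is an eigenvector of \<open>F\<close>.

  Irreducibility enters in two ways. It forces every state to be of the form \<open>i \<cdot> \<sigma>\<close>
  (\<open>irreducible_reachable\<close>), so that no component asks for a minimal upper bound of the empty
  family. And it makes an eigenvector \<open>X\<close> definite (\<open>irreducible_pos_def\<close>): from
  \<open>A\<^sub>\<sigma>\<^sup>T X\<^sub>i A\<^sub>\<sigma> \<preceq> \<lambda> X\<^sub>j\<close> it follows that \<open>A\<^sub>\<sigma>\<close> maps the kernel of \<open>X\<^sub>j\<close> into that of \<open>X\<^sub>i\<close>, hence
  the direct sum of the kernels of the \<open>X\<^sub>j\<close> is an invariant subspace. It is proper as \<open>X \<noteq> 0\<close>,
  so it is trivial.
\<close>

section \<open>Positive semidefinite matrices\<close>

lemma sym_inner_commute: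
  fixes P :: "real^'n^'n"
  assumes "sym_mat P"
  shows "x \<bullet> (P *v y) = y \<bullet> (P *v x)"
  by (metis assms dot_lmul_matrix inner_commute matrix_vector_mul_linear sym_mat_def transpose_matrix_vector)

lemma sym_mat_add: "sym_mat P \<Longrightarrow> sym_mat Q \<Longrightarrow> sym_mat (P + Q)"
  and sym_mat_diff: "sym_mat P \<Longrightarrow> sym_mat Q \<Longrightarrow> sym_mat (P - Q)"
  and sym_mat_scaleR: "sym_mat P \<Longrightarrow> sym_mat (c *\<^sub>R P)"
  and sym_mat_one: "sym_mat (mat 1)"
  by (simp_all add: sym_mat_def transpose_def vec_eq_iff mat_def)

lemma pos_semidef_sym: "pos_semidef P \<Longrightarrow> sym_mat P"
  by (simp add: pos_semidef_def)

lemma pos_semidef_nonneg: "pos_semidef P \<Longrightarrow> 0 \<le> x \<bullet> (P *v x)"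
  by (simp add: pos_semidef_def)

lemma pos_semidef_add: "pos_semidef P \<Longrightarrow> pos_semidef Q \<Longrightarrow> pos_semidef (P + Q)"
  by (simp add: pos_semidef_def sym_mat_add matrix_vector_mult_add_rdistrib inner_add_right)

lemma pos_semidef_scaleR: "0 \<le> c \<Longrightarrow> pos_semidef P \<Longrightarrow> pos_semidef (c *\<^sub>R P)"
  by (simp add: pos_semidef_def sym_mat_scaleR scaleR_matrix_vector_assoc [symmetric])

text \<open>
  The quadratic form is nonnegative on the plane spanned by \<open>x\<close> and \<open>y\<close>, so its discriminant there
  is not positive.
\<close>

lemma pos_semidef_Cauchy_Schwarz:
  assumes "pos_semidef P"
  shows "(x \<bullet> (P *v y))\<^sup>2 \<le> (x \<bullet> (P *v x)) * (y \<bullet> (P *v y))"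
proof -
  let ?a = "x \<bullet> (P *v x)" and ?b = "x \<bullet> (P *v y)" and ?c = "y \<bullet> (P *v y)"
  have q: "0 \<le> s\<^sup>2 * ?a + 2 * s * t * ?b + t\<^sup>2 * ?c" for s t
  proof -
    have "0 \<le> (s *\<^sub>R x + t *\<^sub>R y) \<bullet> (P *v (s *\<^sub>R x + t *\<^sub>R y))"
      using assms by (rule pos_semidef_nonneg)
    also have "\<dots> = s\<^sup>2 * ?a + 2 * s * t * ?b + t\<^sup>2 * ?c"
      using sym_inner_commute [OF pos_semidef_sym [OF assms], of y x]
      by (simp add: matrix_vector_right_distrib inner_add_left inner_add_right
          matrix_vector_mult_scaleR power2_eq_square algebra_simps)
    finally show ?thesis .
  qed
  have a: "0 \<le> ?a" using assms by (rule pos_semidef_nonneg)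
  show ?thesis
  proof (cases "?a = 0")
    case True
    have "?b = 0"
    proof (rule ccontr)
      assume "?b \<noteq> 0"
      then show False
        \<comment> \<open>With \<open>?a = 0\<close> the form is affine in \<open>s\<close>, hence negative for a suitable \<open>s\<close>.\<close>
        using q [of "- (?c + 1) / (2 * ?b)" 1] True by (simp add: field_simps)
    qed
    then show ?thesis using True by simp
  next
    case False
    with a have "0 < ?a" by simp
    have "0 \<le> ?a * (?a * ?c - ?b\<^sup>2)"
      using q [of "- ?b" ?a] by (simp add: power2_eq_square algebra_simps)
    with \<open>0 < ?a\<close> show ?thesis
      by (simp add: zero_le_mult_iff)
  qed
qed

lemma pos_semidef_kernel:
  assumes "pos_semidef P" "x \<bullet> (P *v x) = 0"
  shows "P *v x = 0"
  using pos_semidef_Cauchy_Schwarz [OF assms(1), of "P *v x" x] assms(2) by simp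

definition outer :: "real^'n \<Rightarrow> real^'n^'n" where
  "outer v = (\<chi> i j. v $ i * v $ j)"

lemma outer_mult_vec: "outer v *v x = (v \<bullet> x) *\<^sub>R v"
  by (simp add: outer_def vec_eq_iff matrix_vector_mult_def inner_vec_def sum_distrib_right
      sum_distrib_left algebra_simps)

lemma inner_outer: "outer v \<bullet> Q = v \<bullet> (Q *v v)"
  by (simp add: outer_def inner_vec_def matrix_vector_mult_def sum_distrib_left algebra_simps)

lemma sym_mat_outer: "sym_mat (outer v)"
  by (simp add: sym_mat_def outer_def transpose_def vec_eq_iff mult.commute)

text \<open>
  A positive semidefinite \<open>P\<close> is a sum of rank-one matrices \<open>v v\<^sup>T\<close>, and the inner product of
  \<open>v v\<^sup>T\<close> with \<open>Q\<close> is the value of the quadratic form of \<open>Q\<close> at \<open>v\<close>. The induction splits off one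
  such term at a time: if \<open>P x \<noteq> 0\<close>, then
  \<open>P - (P x) (P x)\<^sup>T / (x \<bullet> P x)\<close> is still positive semidefinite by the Cauchy--Schwarz inequality
  and has \<open>x\<close> as an additional kernel vector.
\<close>

lemma pos_semidef_inner_nonneg:
  fixes P Q :: "real^'n^'n"
  assumes "pos_semidef P" "pos_semidef Q"
  shows "0 \<le> P \<bullet> Q"
  using assms(1)
proof (induction "CARD('n) - dim {x. P *v x = 0}" arbitrary: P rule: less_induct)
  case less
  show ?case
  proof (cases "P = 0")
    case True
    then show ?thesis by simp
  next
    case False
    then obtain x where x: "P *v x \<noteq> 0"
      by (metis matrix_eq matrix_vector_mult_0)
    define a where "a = x \<bullet> (P *v x)"
    have "a \<noteq> 0" using pos_semidef_kernel [OF less.prems] x unfolding a_def by blast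
    then have a: "0 < a"
      using pos_semidef_nonneg [OF less.prems, of x] by (simp add: a_def)
    define P' where "P' = P - (1 / a) *\<^sub>R outer (P *v x)"
    have P'v: "P' *v y = P *v y - ((P *v x) \<bullet> y / a) *\<^sub>R (P *v x)" for y
      by (simp add: P'_def matrix_vector_mult_diff_rdistrib scaleR_matrix_vector_assoc [symmetric]
          outer_mult_vec)
    have psd: "pos_semidef P'"
      unfolding pos_semidef_def
    proof (intro conjI allI)
      show "sym_mat P'"
        using less.prems by (simp add: P'_def sym_mat_diff sym_mat_scaleR sym_mat_outer pos_semidef_sym)
      fix y
      have "(x \<bullet> (P *v y))\<^sup>2 / a \<le> y \<bullet> (P *v y)"
        using pos_semidef_Cauchy_Schwarz [OF less.prems, of x y] a
        by (simp add: a_def divide_simps mult.commute)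
      moreover have "x \<bullet> (P *v y) = (P *v x) \<bullet> y"
        using sym_inner_commute [OF pos_semidef_sym [OF less.prems]] by (simp add: inner_commute)
      ultimately show "0 \<le> y \<bullet> (P' *v y)"
        by (simp add: P'v inner_diff_right power2_eq_square inner_commute)
    qed
    have sub: "subspace {y. M *v y = 0}" for M :: "real^'n^'n"
      by (auto simp: subspace_def matrix_vector_right_distrib matrix_vector_mult_scaleR)
    have "{y. P *v y = 0} \<subset> {y. P' *v y = 0}"
    proof
      show "{y. P *v y = 0} \<subseteq> {y. P' *v y = 0}"
      proof safe
        fix y assume "P *v y = 0"
        moreover from this have "(P *v x) \<bullet> y = 0"
          using sym_inner_commute [OF pos_semidef_sym [OF less.prems], of y x]
          by (simp add: inner_commute)
        ultimately show "P' *v y = 0" by (simp add: P'v)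
      qed
      have "P' *v x = 0" using a by (simp add: P'v a_def inner_commute)
      then show "{y. P *v y = 0} \<noteq> {y. P' *v y = 0}" using x by auto
    qed
    then have "dim {y. P *v y = 0} < dim {y. P' *v y = 0}"
      by (intro dim_psubset) (simp add: sub [THEN span_eq_iff [THEN iffD2]])
    moreover have "dim {y. P' *v y = 0} \<le> CARD('n)"
      using dim_subset_UNIV_cart by blast
    ultimately have "0 \<le> P' \<bullet> Q"
      by (intro less.hyps psd) linarith
    moreover have "P \<bullet> Q = P' \<bullet> Q + (1 / a) * ((P *v x) \<bullet> (Q *v (P *v x)))"
      by (simp add: P'_def inner_diff_left inner_outer)
    moreover have "0 \<le> (1 / a) * ((P *v x) \<bullet> (Q *v (P *v x)))"
      using a pos_semidef_nonneg [OF assms(2)] by simp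
    ultimately show ?thesis by linarith
  qed
qed

text \<open>
  Strict monotonicity of the Frobenius norm: expanding the square of the norm of
  \<open>S = Y + (S - Y)\<close>, the mixed term is nonnegative, so the norm of \<open>S\<close> exceeds that of \<open>Y\<close> as soon
  as \<open>S - Y \<noteq> 0\<close>.
\<close>

lemma loewner_le_norm_le_imp_eq:
  assumes "pos_semidef Y" "Y \<preceq>\<^sub>L S" "norm S \<le> norm Y"
  shows "Y = S"
proof -
  have "0 \<le> Y \<bullet> (S - Y)"
    using assms by (intro pos_semidef_inner_nonneg) (simp_all add: loewner_le_def)
  moreover have "S \<bullet> S = Y \<bullet> Y + 2 * (Y \<bullet> (S - Y)) + (S - Y) \<bullet> (S - Y)"
    by (simp add: inner_diff_left inner_diff_right inner_commute)
  moreover have "S \<bullet> S \<le> Y \<bullet> Y"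
    using assms(3) by (simp add: norm_le)
  ultimately have "(S - Y) \<bullet> (S - Y) \<le> 0" by linarith
  then show ?thesis
    by (metis inner_ge_zero inner_eq_zero_iff order_antisym right_minus_eq)
qed

lemma pos_semidef_above:
  assumes "pos_semidef P" "P \<preceq>\<^sub>L S"
  shows "pos_semidef S"
  using pos_semidef_add [OF assms(1)] assms(2) by (fastforce simp: loewner_le_def)

lemma pos_semidef_mono: "P \<preceq>\<^sub>L Q \<Longrightarrow> x \<bullet> (P *v x) \<le> x \<bullet> (Q *v x)"
  by (simp add: loewner_le_def pos_semidef_def matrix_vector_mult_diff_rdistrib inner_diff_right)

lemma norm_matrix_vector_mult_le:
  fixes P :: "real^'n^'m"
  shows "norm (P *v x) \<le> norm P * norm x"
proof -
  have "norm (P *v x) \<le> L2_set (\<lambda>i. norm (P $ i) * norm x) UNIV"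
    unfolding norm_vec_def [of "P *v x"]
    by (intro L2_set_mono) (simp_all add: matrix_vector_mul_component Cauchy_Schwarz_ineq2)
  also have "\<dots> = norm P * norm x"
    by (simp add: norm_vec_def [of P] L2_set_left_distrib)
  finally show ?thesis .
qed

lemma loewner_le_norm:
  assumes "sym_mat P" "norm P \<le> c"
  shows "P \<preceq>\<^sub>L c *\<^sub>R mat 1"
  unfolding loewner_le_def pos_semidef_def
proof (intro conjI allI)
  show "sym_mat (c *\<^sub>R mat 1 - P)"
    using assms by (simp add: sym_mat_diff sym_mat_scaleR sym_mat_one)
  fix x
  have "x \<bullet> (P *v x) \<le> norm x * norm (P *v x)" by (rule norm_cauchy_schwarz)
  also have "\<dots> \<le> norm x * (c * norm x)"
    using norm_matrix_vector_mult_le [of P x] assms(2)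
    by (meson mult_left_mono mult_right_mono norm_ge_zero order_trans)
  also have "\<dots> = x \<bullet> ((c *\<^sub>R mat 1) *v x)"
    by (simp add: scaleR_matrix_vector_assoc [symmetric] dot_square_norm power2_eq_square)
  finally show "0 \<le> x \<bullet> ((c *\<^sub>R mat 1 - P) *v x)"
    by (simp add: matrix_vector_mult_diff_rdistrib inner_diff_right)
qed

text \<open>
  The value of the quadratic form at a fixed vector is linear in the matrix, so the cone is an
  intersection of hyperplanes and closed half-spaces.
\<close>

lemma closed_pos_semidef: "closed {P :: real^'n^'n. pos_semidef P}"
proof -
  have "{P :: real^'n^'n. pos_semidef P} =
      (\<Inter>i. \<Inter>j. {P. P $ i $ j = P $ j $ i}) \<inter> (\<Inter>x. {P. 0 \<le> outer x \<bullet> P})"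
    unfolding inner_outer by (auto simp: pos_semidef_def sym_mat_def transpose_def vec_eq_iff)
  also have "closed \<dots>"
    by (intro closed_Int closed_INT ballI closed_Collect_eq closed_Collect_le continuous_intros)
  finally show ?thesis .
qed


text \<open>
  The inner product with the identity is the trace, so the matrices in the cone with bounded
  trace are bounded. The inequality results from pairing \<open>P\<close> with
  the positive semidefinite matrix \<open>norm P *\<^sub>R mat 1 - P\<close>.
\<close>

lemma norm_le_inner_mat_1:
  fixes P :: "real^'n^'n"
  assumes "pos_semidef P"
  shows "norm P \<le> P \<bullet> mat 1"
proof (cases "P = 0")
  case False
  have "0 \<le> P \<bullet> (norm P *\<^sub>R mat 1 - P)"
    using loewner_le_norm [of P "norm P"] assms
    by (intro pos_semidef_inner_nonneg) (simp_all add: loewner_le_def pos_semidef_sym)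
  then have "norm P * norm P \<le> norm P * (P \<bullet> mat 1)"
    by (simp add: inner_diff_right dot_square_norm power2_eq_square)
  then show ?thesis using False by simp
qed simp

lemma pos_semidef_congruence:
  fixes P B :: "real^'n^'n"
  assumes "pos_semidef P"
  shows "pos_semidef (transpose B ** P ** B)"
    and "x \<bullet> ((transpose B ** P ** B) *v x) = (B *v x) \<bullet> (P *v (B *v x))"
proof -
  have "x \<bullet> (y v* B) = (B *v x) \<bullet> y" for x y
    using dot_lmul_matrix [of y B x] by (simp add: inner_commute)
  then have q: "x \<bullet> ((transpose B ** P ** B) *v x) = (B *v x) \<bullet> (P *v (B *v x))" for x
    by (simp add: matrix_vector_mul_assoc [symmetric])
  show "x \<bullet> ((transpose B ** P ** B) *v x) = (B *v x) \<bullet> (P *v (B *v x))" by (rule q)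
  show "pos_semidef (transpose B ** P ** B)"
    using assms unfolding pos_semidef_def q
    by (simp add: sym_mat_def matrix_transpose_mul matrix_mul_assoc)
qed

section \<open>The upper bound of least norm\<close>

lemma closed_sym_upper_bounds: "closed (sym_upper_bounds \<Q>)"
proof -
  have "sym_upper_bounds \<Q> = (\<Inter>i. \<Inter>j. {S. S $ i $ j = S $ j $ i}) \<inter>
      (\<Inter>Q\<in>\<Q>. (\<lambda>S. S - Q) -` {P. pos_semidef P})"
    by (auto simp: sym_upper_bounds_def loewner_le_def sym_mat_def transpose_def vec_eq_iff)
  also have "closed \<dots>"
    by (intro closed_Int closed_INT ballI closed_Collect_eq continuous_intros
        closed_vimage closed_pos_semidef)
  finally show ?thesis .
qed

lemma convex_sym_upper_bounds: "convex (sym_upper_bounds \<Q>)"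
proof (rule convexI)
  fix S T and u v :: real
  assume S: "S \<in> sym_upper_bounds \<Q>" and T: "T \<in> sym_upper_bounds \<Q>"
    and uv: "0 \<le> u" "0 \<le> v" "u + v = 1"
  have "u *\<^sub>R S + v *\<^sub>R T - Q = u *\<^sub>R (S - Q) + v *\<^sub>R (T - Q)" for Q
    using scaleR_add_left [of u v Q] uv(3) by (simp add: algebra_simps)
  with S T uv show "u *\<^sub>R S + v *\<^sub>R T \<in> sym_upper_bounds \<Q>"
    by (auto simp: sym_upper_bounds_def loewner_le_def
        intro!: sym_mat_add sym_mat_scaleR pos_semidef_add pos_semidef_scaleR)
qed

lemma sym_upper_bounds_nonempty:
  fixes \<Q> :: "(real^'n^'n) set"
  assumes "finite \<Q>" "\<And>Q. Q \<in> \<Q> \<Longrightarrow> sym_mat Q"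
  shows "sym_upper_bounds \<Q> \<noteq> {}"
proof -
  have "Q \<preceq>\<^sub>L (\<Sum>R\<in>\<Q>. norm R) *\<^sub>R mat 1" if "Q \<in> \<Q>" for Q
    using assms that by (intro loewner_le_norm member_le_sum) auto
  then have "(\<Sum>R\<in>\<Q>. norm R) *\<^sub>R mat 1 \<in> sym_upper_bounds \<Q>"
    by (simp add: sym_upper_bounds_def sym_mat_scaleR sym_mat_one)
  then show ?thesis by blast
qed

definition least_norm_ub :: "(real^'n^'n) set \<Rightarrow> real^'n^'n" where
  "least_norm_ub \<Q> = closest_point (sym_upper_bounds \<Q>) 0"

lemma least_norm_ub_in:
  assumes "finite \<Q>" "\<And>Q. Q \<in> \<Q> \<Longrightarrow> sym_mat Q"
  shows "least_norm_ub \<Q> \<in> sym_upper_bounds \<Q>"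
  unfolding least_norm_ub_def
  by (intro closest_point_in_set closed_sym_upper_bounds sym_upper_bounds_nonempty assms)

lemma norm_least_norm_ub_le:
  assumes "S \<in> sym_upper_bounds \<Q>"
  shows "norm (least_norm_ub \<Q>) \<le> norm S"
  using closest_point_le [OF closed_sym_upper_bounds assms, of 0] by (simp add: least_norm_ub_def)

text \<open>
  An upper bound of a nonempty family of positive semidefinite matrices is itself positive
  semidefinite, so strict monotonicity of the norm applies to any upper bound below the one of
  least norm.
\<close>

lemma least_norm_ub_minimal:
  assumes "finite \<Q>" "\<Q> \<noteq> {}" "\<And>Q. Q \<in> \<Q> \<Longrightarrow> pos_semidef Q"
  shows "least_norm_ub \<Q> \<in> minimal_upper_bounds \<Q>"
proof -
  obtain Q where Q: "Q \<in> \<Q>" using assms(2) by blast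
  have "Y = least_norm_ub \<Q>" if Y: "Y \<in> sym_upper_bounds \<Q>" "Y \<preceq>\<^sub>L least_norm_ub \<Q>" for Y
  proof (rule loewner_le_norm_le_imp_eq)
    show "pos_semidef Y"
      using Y(1) Q assms(3) by (auto simp: sym_upper_bounds_def intro: pos_semidef_above)
  qed (use Y norm_least_norm_ub_le in auto)
  moreover have "least_norm_ub \<Q> \<in> sym_upper_bounds \<Q>"
    using assms by (intro least_norm_ub_in) (auto intro: pos_semidef_sym)
  ultimately show ?thesis by (simp add: minimal_upper_bounds_def)
qed

text \<open>
  Moving every member of the family by at most \<open>e\<close> moves the set of upper bounds by no more than
  the translation by \<open>e *\<^sub>R mat 1\<close>. This is the source of continuity.
\<close>

lemma sym_upper_bounds_perturb:
  fixes Q R :: "'i \<Rightarrow> real^'n^'n"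
  assumes "S \<in> sym_upper_bounds (R ` I)"
    and "\<And>i. i \<in> I \<Longrightarrow> sym_mat (Q i)" "\<And>i. i \<in> I \<Longrightarrow> sym_mat (R i)"
    and "\<And>i. i \<in> I \<Longrightarrow> norm (Q i - R i) \<le> e"
  shows "S + e *\<^sub>R mat 1 \<in> sym_upper_bounds (Q ` I)"
proof -
  have "pos_semidef (S + e *\<^sub>R mat 1 - Q i)" if i: "i \<in> I" for i
  proof -
    have "pos_semidef (e *\<^sub>R mat 1 - (Q i - R i))"
      using loewner_le_norm [of "Q i - R i" e] i assms by (simp add: loewner_le_def sym_mat_diff)
    moreover have "pos_semidef (S - R i)"
      using assms(1) i by (simp add: sym_upper_bounds_def loewner_le_def)
    ultimately have "pos_semidef ((S - R i) + (e *\<^sub>R mat 1 - (Q i - R i)))"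
      by (intro pos_semidef_add)
    then show ?thesis by (simp add: algebra_simps)
  qed
  then show ?thesis
    using assms(1) by (simp add: sym_upper_bounds_def loewner_le_def sym_mat_add sym_mat_scaleR sym_mat_one)
qed

text \<open>
  Let \<open>s\<close> and \<open>t\<close> be the two bounds and \<open>d = e *\<^sub>R mat 1\<close>. As \<open>s + d\<close> bounds the family of \<open>t\<close>, the
  norm of \<open>t + d\<close> is at most that of \<open>s\<close> up to a multiple of \<open>e\<close>. As \<open>t + d\<close> bounds the family of
  \<open>s\<close>, so does its midpoint with \<open>s\<close>, which therefore has norm at least that of \<open>s\<close>. By the
  parallelogram law two vectors of almost equal norm whose midpoint is not much shorter are close
  to each other. What matters about the resulting estimate is that it depends only on \<open>e\<close> and \<open>s\<close>
  and tends to \<open>0\<close> with \<open>e\<close>.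
\<close>

lemma norm_diff_least_norm_ub_le:
  fixes Q R :: "'i \<Rightarrow> real^'n^'n"
  assumes fin: "finite I" and e: "0 \<le> e"
    and sym: "\<And>i. i \<in> I \<Longrightarrow> sym_mat (Q i)" "\<And>i. i \<in> I \<Longrightarrow> sym_mat (R i)"
    and near: "\<And>i. i \<in> I \<Longrightarrow> norm (Q i - R i) \<le> e"
  defines "c \<equiv> norm (mat 1 :: real^'n^'n)" and "s \<equiv> least_norm_ub (Q ` I)"
  shows "norm (least_norm_ub (R ` I) - s)
           \<le> e * c + sqrt (2 * ((norm s + 2 * (e * c))\<^sup>2 - (norm s)\<^sup>2))"
proof -
  define t where "t = least_norm_ub (R ` I)"
  define d where "d = e *\<^sub>R (mat 1 :: real^'n^'n)"
  have d: "norm d = e * c" using e by (simp add: d_def c_def)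
  have s: "s \<in> sym_upper_bounds (Q ` I)" and t: "t \<in> sym_upper_bounds (R ` I)"
    unfolding s_def t_def using fin sym by (auto intro!: least_norm_ub_in)
  have "s + d \<in> sym_upper_bounds (R ` I)"
    unfolding d_def using s sym near
    by (intro sym_upper_bounds_perturb [of _ Q]) (auto simp: norm_minus_commute)
  then have "norm t \<le> norm (s + d)" unfolding t_def by (rule norm_least_norm_ub_le)
  also have "\<dots> \<le> norm s + e * c" using norm_triangle_ineq [of s d] d by simp
  finally have t_le: "norm t \<le> norm s + e * c" .
  have "t + d \<in> sym_upper_bounds (Q ` I)"
    unfolding d_def using t sym near by (intro sym_upper_bounds_perturb) auto
  with s have "(1/2) *\<^sub>R s + (1/2) *\<^sub>R (t + d) \<in> sym_upper_bounds (Q ` I)"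
    by (intro convexD [OF convex_sym_upper_bounds]) auto
  then have "norm s \<le> norm ((1/2) *\<^sub>R s + (1/2) *\<^sub>R (t + d))"
    unfolding s_def by (rule norm_least_norm_ub_le)
  also have "\<dots> = norm (s + (t + d)) / 2"
    by (simp flip: scaleR_add_right)
  finally have "(2 * norm s)\<^sup>2 \<le> (norm (s + (t + d)))\<^sup>2"
    by (intro power_mono) auto
  moreover have "(norm (s + (t + d)))\<^sup>2 + (norm (t + d - s))\<^sup>2 = 2 * (norm s)\<^sup>2 + 2 * (norm (t + d))\<^sup>2"
    by (simp add: power2_norm_eq_inner inner_add_left inner_add_right inner_diff_left
        inner_diff_right inner_commute)
  moreover have "(norm (t + d))\<^sup>2 \<le> (norm s + 2 * (e * c))\<^sup>2"
    using norm_triangle_ineq [of t d] d t_le by (intro power_mono) auto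
  ultimately have "(norm (t + d - s))\<^sup>2 \<le> 2 * ((norm s + 2 * (e * c))\<^sup>2 - (norm s)\<^sup>2)"
    by (simp add: power_mult_distrib)
  then have "norm (t + d - s) \<le> sqrt (2 * ((norm s + 2 * (e * c))\<^sup>2 - (norm s)\<^sup>2))"
    by (rule real_le_rsqrt)
  moreover have "norm (t - s) \<le> norm (t + d - s) + norm d"
    using norm_triangle_ineq4 [of "t + d - s" d] by (simp add: algebra_simps)
  ultimately show ?thesis using d by (simp add: t_def)
qed

lemma continuous_on_least_norm_ub:
  fixes Q :: "'i \<Rightarrow> 'a::metric_space \<Rightarrow> real^'n^'n"
  assumes fin: "finite I"
    and cont: "\<And>i. i \<in> I \<Longrightarrow> continuous_on S (Q i)"
    and sym: "\<And>i x. i \<in> I \<Longrightarrow> x \<in> S \<Longrightarrow> sym_mat (Q i x)"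
  shows "continuous_on S (\<lambda>x. least_norm_ub ((\<lambda>i. Q i x) ` I))"
  unfolding continuous_on_def
proof
  fix x assume x: "x \<in> S"
  let ?F = "\<lambda>x. least_norm_ub ((\<lambda>i. Q i x) ` I)"
  define c where "c = norm (mat 1 :: real^'n^'n)"
  define e where "e y = (\<Sum>i\<in>I. norm (Q i x - Q i y))" for y
  define b where "b r = r * c + sqrt (2 * ((norm (?F x) + 2 * (r * c))\<^sup>2 - (norm (?F x))\<^sup>2))" for r
  have "((\<lambda>y. norm (Q i x - Q i y)) \<longlongrightarrow> norm (Q i x - Q i x)) (at x within S)" if "i \<in> I" for i
    using cont [OF that] x by (intro tendsto_intros) (auto simp: continuous_on_def)
  then have "(e \<longlongrightarrow> (\<Sum>i\<in>I. norm (Q i x - Q i x))) (at x within S)"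
    unfolding e_def by (intro tendsto_sum)
  then have "(e \<longlongrightarrow> 0) (at x within S)" by simp
  then have "((\<lambda>y. b (e y)) \<longlongrightarrow> b 0) (at x within S)"
    unfolding b_def by (intro tendsto_intros)
  moreover have "b 0 = 0" by (simp add: b_def)
  ultimately have b: "((\<lambda>y. b (e y)) \<longlongrightarrow> 0) (at x within S)" by simp
  have "norm (?F y - ?F x) \<le> b (e y)" if "y \<in> S" for y
    unfolding b_def c_def
    using fin sym x that
    by (intro norm_diff_least_norm_ub_le) (auto simp: e_def intro!: sum_nonneg member_le_sum)
  then have "\<forall>\<^sub>F y in at x within S. norm (?F y - ?F x) \<le> b (e y)"
    by (simp add: eventually_at_filter)
  then have "((\<lambda>y. ?F y - ?F x) \<longlongrightarrow> 0) (at x within S)"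
    using b by (rule Lim_null_comparison)
  then show "(?F \<longlongrightarrow> ?F x) (at x within S)"
    by (rule LIM_zero_cancel)
qed

section \<open>The tropical Kraus map\<close>

text \<open>
  The family of which \<open>tropical_kraus A act X j\<close> consists of the minimal upper bounds, indexed
  by pairs \<open>(i, \<sigma>)\<close> so that it is an image of a finite index set that does not depend on \<open>X\<close>, as
  continuity in \<open>X\<close> requires.
\<close>

definition kraus_images ::
  "('s::finite \<Rightarrow> real^'n^'n) \<Rightarrow> ('w::finite \<Rightarrow> 's \<Rightarrow> 'w) \<Rightarrow> ('w \<Rightarrow> real^'n^'n) \<Rightarrow> 'w \<Rightarrow> (real^'n^'n) set"
  where
  "kraus_images A act X j =
     (\<lambda>k. transpose (A (snd k)) ** X (fst k) ** A (snd k)) ` {k. act (fst k) (snd k) = j}"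

lemma kraus_imagesI:
  "act i \<sigma> = j \<Longrightarrow> transpose (A \<sigma>) ** X i ** A \<sigma> \<in> kraus_images A act X j"
  unfolding kraus_images_def by (rule image_eqI [of _ _ "(i, \<sigma>)"]) auto

lemma tropical_kraus_eq: "tropical_kraus A act X j = minimal_upper_bounds (kraus_images A act X j)"
proof -
  have "{transpose (A \<sigma>) ** X i ** A \<sigma> |i \<sigma>. act i \<sigma> = j} = kraus_images A act X j"
    by (auto intro: kraus_imagesI) (auto simp: kraus_images_def)
  then show ?thesis by (simp add: tropical_kraus_def)
qed

lemma kraus_images_pos_semidef:
  assumes "\<And>i. pos_semidef (X i)" "Q \<in> kraus_images A act X j"
  shows "pos_semidef Q"
  using assms by (auto simp: kraus_images_def intro: pos_semidef_congruence)

lemma kraus_images_finite: "finite (kraus_images A act X j)"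
  by (simp add: kraus_images_def)

section \<open>Consequences of irreducibility\<close>

definition state_block :: "'w::finite \<Rightarrow> real^('w \<times> 'n::finite) \<Rightarrow> real^'n" where
  "state_block j v = (\<chi> c. v $ (j, c))"

text \<open>
  The matrix \<open>E\<^sub>i\<^sub>j \<otimes> B\<close> reads block \<open>j\<close>, applies \<open>B\<close>, and writes the result to block \<open>i\<close>.
\<close>

lemma state_block_kronecker:
  "state_block k ((matrix_unit i j \<otimes>\<^sub>K B) *v v) = (if k = i then B *v state_block j v else 0)"
proof -
  have "(\<Sum>q\<in>UNIV. (if k = i \<and> fst q = j then 1 else 0) * B $ r $ snd q * v $ q)
      = (if k = i then \<Sum>c\<in>UNIV. B $ r $ c * v $ (j, c) else 0)" for r
  proof -
    have "(\<Sum>q\<in>UNIV. (if k = i \<and> fst q = j then 1 else 0) * B $ r $ snd q * v $ q)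
      = (\<Sum>l\<in>UNIV. \<Sum>c\<in>UNIV. (if k = i \<and> l = j then 1 else 0) * B $ r $ c * v $ (l, c))"
      by (simp add: sum.cartesian_product case_prod_unfold)
    also have "\<dots> = (\<Sum>l\<in>UNIV. if l = j then (if k = i then \<Sum>c\<in>UNIV. B $ r $ c * v $ (j, c) else 0) else 0)"
      by (intro sum.cong) auto
    finally show ?thesis by simp
  qed
  then show ?thesis
    by (simp add: vec_eq_iff state_block_def kronecker_def matrix_unit_def matrix_vector_mult_def)
qed

lemma state_block_linear:
  "state_block j 0 = 0"
  "state_block j (u + v) = state_block j u + state_block j v"
  "state_block j (c *\<^sub>R v) = c *\<^sub>R state_block j v"
  by (simp_all add: state_block_def vec_eq_iff)

lemma ex_state_block: "\<exists>v. state_block j v = x \<and> (\<forall>k. k \<noteq> j \<longrightarrow> state_block k v = 0)"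
  by (rule exI [of _ "\<chi> q. if fst q = j then x $ snd q else 0"])
    (simp add: state_block_def vec_eq_iff)

text \<open>
  Irreducibility for subspaces that are direct sums of one subspace \<open>W j\<close> per block: by the
  action of \<open>E\<^sub>i\<^sub>j \<otimes> A\<^sub>\<sigma>\<close> on blocks, such a sum is invariant when \<open>A \<sigma>\<close> maps \<open>W (act i \<sigma>)\<close> into
  \<open>W i\<close>.
\<close>

lemma irreducible_blocks:
  fixes A :: "'s::finite \<Rightarrow> real^'n^'n" and act :: "'w::finite \<Rightarrow> 's \<Rightarrow> 'w"
  assumes irr: "irreducible_mats {matrix_unit i j \<otimes>\<^sub>K A \<sigma> | i j \<sigma>. act i \<sigma> = j}"
    and sub: "\<And>j. subspace (W j)"
    and inv: "\<And>i \<sigma> x. x \<in> W (act i \<sigma>) \<Longrightarrow> A \<sigma> *v x \<in> W i"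
  shows "(\<forall>j. W j = {0}) \<or> (\<forall>j. W j = UNIV)"
proof -
  define V where "V = {v. \<forall>j. state_block j v \<in> W j}"
  have "subspace V"
    using sub by (auto simp: V_def subspace_def state_block_linear)
  moreover have "B *v v \<in> V" if "B \<in> {matrix_unit i j \<otimes>\<^sub>K A \<sigma> | i j \<sigma>. act i \<sigma> = j}" "v \<in> V" for B v
    using that inv sub by (auto simp: V_def state_block_kronecker subspace_0)
  ultimately have "V = {0} \<or> V = UNIV"
    using irr unfolding irreducible_mats_def by blast
  moreover have "\<exists>v\<in>V. state_block j v = x" if "x \<in> W j" for j x
    using ex_state_block [of j x] that sub unfolding V_def mem_Collect_eq Bex_def
    by (metis subspace_0)
  moreover have "x \<in> W j" if "V = UNIV" for x j
    using ex_state_block [of j x] that unfolding V_def by blast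
  ultimately show ?thesis
    using sub
    by (metis UNIV_eq_I insertI1 singletonD state_block_linear(1) subset_antisym
        subset_singletonD subsetI subspace_0)
qed

text \<open>
  If \<open>j\<close> were not reached from any state, no matrix would read block \<open>j\<close>, and the vectors supported
  there would form an invariant subspace. It is nonzero, and it is proper because
  \<open>act j \<sigma>\<close>, for any \<open>\<sigma>\<close>, is a state other than \<open>j\<close>.
\<close>

lemma irreducible_reachable:
  fixes A :: "'s::finite \<Rightarrow> real^'n^'n" and act :: "'w::finite \<Rightarrow> 's \<Rightarrow> 'w"
  assumes "irreducible_mats {matrix_unit i j \<otimes>\<^sub>K A \<sigma> | i j \<sigma>. act i \<sigma> = j}"
  shows "\<exists>i \<sigma>. act i \<sigma> = j"
proof (rule ccontr)
  assume no: "\<nexists>i \<sigma>. act i \<sigma> = j"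
  define W :: "'w \<Rightarrow> (real^'n) set" where "W k = (if k = j then UNIV else {0})" for k
  have "(\<forall>k. W k = {0}) \<or> (\<forall>k. W k = UNIV)"
  proof (rule irreducible_blocks [OF assms])
    show "subspace (W k)" for k by (simp add: W_def)
    show "A \<sigma> *v x \<in> W i" if "x \<in> W (act i \<sigma>)" for i \<sigma> x
      using that no by (auto simp: W_def subspace_0)
  qed
  moreover have "(UNIV :: (real^'n) set) \<noteq> {0}"
    by (metis UNIV_I axis_eq_0_iff singletonD zero_neq_one)
  moreover have "act j undefined \<noteq> j" using no by blast
  ultimately show False by (metis W_def)
qed

text \<open>
  If \<open>X (act i \<sigma>)\<close> annihilates \<open>x\<close>, then the quadratic form of \<open>X i\<close> is nonpositive at \<open>A \<sigma> *v x\<close>,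
  so \<open>X i\<close> annihilates \<open>A \<sigma> *v x\<close>. The kernels of the \<open>X j\<close> thus form an invariant family of
  subspaces, and not all of them are the whole space.
\<close>

lemma irreducible_pos_def:
  fixes A :: "'s::finite \<Rightarrow> real^'n^'n" and act :: "'w::finite \<Rightarrow> 's \<Rightarrow> 'w"
  assumes irr: "irreducible_mats {matrix_unit i j \<otimes>\<^sub>K A \<sigma> | i j \<sigma>. act i \<sigma> = j}"
    and psd: "\<And>j. pos_semidef (X j)"
    and ub: "\<And>j. ev *\<^sub>R X j \<in> sym_upper_bounds (kraus_images A act X j)"
    and nz: "X k \<noteq> 0"
  shows "pos_def (X j)"
proof -
  define W where "W j = {x. X j *v x = 0}" for j
  have "(\<forall>j. W j = {0}) \<or> (\<forall>j. W j = UNIV)"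
  proof (rule irreducible_blocks [OF irr])
    show "subspace (W j)" for j
      by (auto simp: W_def subspace_def matrix_vector_right_distrib matrix_vector_mult_scaleR)
    fix i \<sigma> x assume x: "x \<in> W (act i \<sigma>)"
    have "transpose (A \<sigma>) ** X i ** A \<sigma> \<in> kraus_images A act X (act i \<sigma>)"
      by (simp add: kraus_imagesI)
    then have "transpose (A \<sigma>) ** X i ** A \<sigma> \<preceq>\<^sub>L ev *\<^sub>R X (act i \<sigma>)"
      using ub by (simp add: sym_upper_bounds_def)
    from pos_semidef_mono [OF this, of x] x
    have "(A \<sigma> *v x) \<bullet> (X i *v (A \<sigma> *v x)) \<le> 0"
      by (simp add: pos_semidef_congruence(2) [OF psd] W_def scaleR_matrix_vector_assoc [symmetric])
    with pos_semidef_nonneg [OF psd] have "(A \<sigma> *v x) \<bullet> (X i *v (A \<sigma> *v x)) = 0"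
      by (simp add: order_antisym)
    then show "A \<sigma> *v x \<in> W i"
      using pos_semidef_kernel [OF psd] by (simp add: W_def)
  qed
  moreover have "W k \<noteq> UNIV"
    using nz by (auto simp: W_def matrix_eq set_eq_iff)
  ultimately have "W j = {0}" by blast
  then have "x \<bullet> (X j *v x) \<noteq> 0" if "x \<noteq> 0" for x
    using that pos_semidef_kernel [OF psd] by (auto simp: W_def)
  then show ?thesis
    using psd [of j] by (auto simp: pos_def_def pos_semidef_def order_less_le)
qed

section \<open>Existence of an eigenvector\<close>

text \<open>
  The inner product with the tuple of identity matrices is the sum of the traces of the
  components. Read as block diagonal matrices, these are the density matrices, that is, the
  positive semidefinite matrices of trace one.
\<close>

definition density_tuples :: "(real^'n^'n^'w) set" where
  "density_tuples = {X. (\<forall>j. pos_semidef (X $ j)) \<and> X \<bullet> (\<chi> j. mat 1) = 1}"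

lemma norm_le_inner_identity_tuple:
  fixes X :: "real^'n^'n^'w"
  assumes "\<And>j. pos_semidef (X $ j)"
  shows "norm X \<le> X \<bullet> (\<chi> j. mat 1)"
proof -
  have "norm X \<le> (\<Sum>j\<in>UNIV. norm (X $ j))"
    unfolding norm_vec_def by (rule L2_set_le_sum) simp
  also have "\<dots> \<le> (\<Sum>j\<in>UNIV. X $ j \<bullet> mat 1)"
    by (intro sum_mono norm_le_inner_mat_1 assms)
  also have "\<dots> = X \<bullet> (\<chi> j. mat 1)" by (simp add: inner_vec_def [of X])
  finally show ?thesis .
qed

lemma compact_density_tuples: "compact (density_tuples :: (real^'n^'n^'w) set)"
proof -
  have "density_tuples = (\<Inter>j. (\<lambda>X. X $ j) -` {P. pos_semidef P})
      \<inter> {X :: real^'n^'n^'w. X \<bullet> (\<chi> j. mat 1) = 1}"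
    by (auto simp: density_tuples_def)
  also have "closed \<dots>"
    by (intro closed_Int closed_INT ballI closed_vimage closed_pos_semidef closed_Collect_eq
        continuous_intros)
  finally have "closed (density_tuples :: (real^'n^'n^'w) set)" .
  moreover have "bounded (density_tuples :: (real^'n^'n^'w) set)"
    using norm_le_inner_identity_tuple by (force simp: bounded_iff density_tuples_def)
  ultimately show ?thesis by (simp add: compact_eq_bounded_closed)
qed

lemma convex_density_tuples: "convex (density_tuples :: (real^'n^'n^'w) set)"
  by (rule convexI) (auto simp: density_tuples_def inner_add_left intro!: pos_semidef_add pos_semidef_scaleR)

lemma scaled_in_density_tuples:
  fixes Y :: "real^'n^'n^'w"
  assumes "\<And>j. pos_semidef (Y $ j)" "Y \<noteq> 0"
  shows "(1 / (Y \<bullet> (\<chi> j. mat 1))) *\<^sub>R Y \<in> density_tuples"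
proof -
  have "0 < Y \<bullet> (\<chi> j. mat 1)"
    using norm_le_inner_identity_tuple [OF assms(1)] assms(2) by (smt (verit) zero_less_norm_iff)
  then show ?thesis
    using assms(1) by (auto simp: density_tuples_def intro!: pos_semidef_scaleR)
qed

theorem corollary1:
  fixes A :: "'s::finite \<Rightarrow> real^'n::finite^'n"
    and act :: "'w::finite \<Rightarrow> 's \<Rightarrow> 'w"
  assumes "irreducible_mats {matrix_unit i j \<otimes>\<^sub>K A \<sigma> | i j \<sigma>. act i \<sigma> = j}"
  shows "\<exists>(ev::real) (X :: 'w \<Rightarrow> real^'n^'n).
           (\<forall>j. pos_def (X j)) \<and> (\<forall>j. ev *\<^sub>R X j \<in> tropical_kraus A act X j)"
proof -
  define F :: "real^'n^'n^'w \<Rightarrow> real^'n^'n^'w"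
    where "F X = (\<chi> j. least_norm_ub (kraus_images A act (($) X) j))" for X
  define tr where "tr X = X \<bullet> (\<chi> j. mat 1)" for X :: "real^'n^'n^'w"
  have psd: "pos_semidef (X $ j)" if "X \<in> density_tuples" for X :: "real^'n^'n^'w" and j
    using that by (simp add: density_tuples_def)
  have F_minimal: "F X $ j \<in> tropical_kraus A act (($) X) j" if "X \<in> density_tuples" for X j
    unfolding F_def tropical_kraus_eq vec_lambda_beta
  proof (intro least_norm_ub_minimal kraus_images_finite)
    show "kraus_images A act (($) X) j \<noteq> {}"
      using irreducible_reachable [OF assms, of j] by (blast intro: kraus_imagesI)
    show "pos_semidef Q" if "Q \<in> kraus_images A act (($) X) j" for Q
      using kraus_images_pos_semidef [OF psd [OF \<open>X \<in> density_tuples\<close>] that] .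
  qed
  have F_psd: "pos_semidef (F X $ j)" if X: "X \<in> density_tuples" for X j
  proof -
    obtain Q where Q: "Q \<in> kraus_images A act (($) X) j"
      using irreducible_reachable [OF assms, of j] by (blast intro: kraus_imagesI)
    moreover have "Q \<preceq>\<^sub>L F X $ j"
      using F_minimal [OF X, of j] Q
      by (simp add: tropical_kraus_eq minimal_upper_bounds_def sym_upper_bounds_def)
    ultimately show ?thesis
      using kraus_images_pos_semidef [OF psd [OF X] Q] by (blast intro: pos_semidef_above)
  qed
  have F_cont: "continuous_on density_tuples F"
    unfolding F_def kraus_images_def
  proof (intro continuous_on_vec_lambda continuous_on_least_norm_ub)
    fix k :: "'w \<times> 's"
    show "continuous_on density_tuples
        (\<lambda>X. transpose (A (snd k)) ** X $ fst k ** A (snd k))"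
      by (simp add: matrix_matrix_mult_def) (intro continuous_intros)
  qed (auto intro!: pos_semidef_sym pos_semidef_congruence psd)
  have eigenvector_if: ?thesis if X: "X \<in> density_tuples" and F: "F X = ev *\<^sub>R X" for X ev
  proof (intro exI conjI allI)
    have ev: "ev *\<^sub>R X $ j \<in> tropical_kraus A act (($) X) j" for j
      using F_minimal [OF X, of j] F by simp
    then show "ev *\<^sub>R X $ j \<in> tropical_kraus A act (($) X) j" for j .
    have "X \<noteq> 0" using X by (auto simp: density_tuples_def)
    then obtain k where "X $ k \<noteq> 0" by (auto simp: vec_eq_iff)
    then show "pos_def (X $ j)" for j
      using ev by (intro irreducible_pos_def [OF assms psd [OF X]])
        (auto simp: tropical_kraus_eq minimal_upper_bounds_def)
  qed
  show ?thesis
  proof (cases "\<exists>X\<in>density_tuples. F X = 0")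
    case True
    then obtain X where "X \<in> density_tuples" "F X = 0 *\<^sub>R X" by auto
    then show ?thesis by (rule eigenvector_if)
  next
    case False
    have maps: "(1 / tr (F X)) *\<^sub>R F X \<in> density_tuples" if "X \<in> density_tuples" for X
      unfolding tr_def using that False F_psd by (intro scaled_in_density_tuples) auto
    have tr_nz: "tr (F X) \<noteq> 0" if "X \<in> density_tuples" for X
      using norm_le_inner_identity_tuple [OF F_psd [OF that]] False that by (auto simp: tr_def)
    have "(1 / tr (\<chi> j. mat 1)) *\<^sub>R (\<chi> j. mat 1) \<in> (density_tuples :: (real^'n^'n^'w) set)"
      unfolding tr_def
    proof (rule scaled_in_density_tuples)
      show "pos_semidef ((\<chi> j. mat 1) $ j :: real^'n^'n)" for j :: 'w
        by (simp add: pos_semidef_def sym_mat_one)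
      show "(\<chi> j. mat 1) \<noteq> (0 :: real^'n^'n^'w)"
        by (simp add: vec_eq_iff mat_def)
    qed
    then have "(density_tuples :: (real^'n^'n^'w) set) \<noteq> {}" by blast
    moreover have "continuous_on density_tuples (\<lambda>X. (1 / tr (F X)) *\<^sub>R F X)"
      using tr_nz unfolding tr_def by (intro continuous_intros F_cont) auto
    ultimately obtain X where X: "X \<in> density_tuples" "(1 / tr (F X)) *\<^sub>R F X = X"
      using brouwer [OF compact_density_tuples convex_density_tuples,
          of "\<lambda>X. (1 / tr (F X)) *\<^sub>R F X"] maps by blast
    then have "F X = tr (F X) *\<^sub>R X"
      using tr_nz [OF X(1)]
      by (metis divide_self_if mult.commute scaleR_one scaleR_scaleR times_divide_eq_right mult_1_right)
    then show ?thesis by (rule eigenvector_if [OF X(1)])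
  qed
qed

end
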